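(* Let $(L,\cdot)$ be a left Leibniz algebra over a field $\mathbb{K}$ of characteristic $0$, and let $x^n$ denote the $n$th right power of $x\in L$. Then: (i) $x^n=0$ for all $n\ge 3$ and all $x\in L$; (ii) $(L,\cdot)$ is power-associative if and only if $x\cdot x^2 = 0$ for all $x\in L$.
   Context: A left Leibniz algebra is a $\mathbb{K}$-vector space $L$ with a bilinear operation $\cdot$ satisfying $x\cdot(y\cdot z) = (x\cdot y)\cdot z + y\cdot(x\cdot z)$ for all $x,y,z\in L$. Right powers are defined by $x^1=x$ and $x^{n+1}=x^n\cdot x$ for $n\ge 1$. The algebra is power-associative if $x^n = x^{n-i}\cdot x^i$ for all $x\in L$, all $n\ge 2$ and all $i\in\{1,\dots,n-1\}$. *)

theory Defs
  imports Complex_Main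
begin

locale left_leibniz_algebra = vector_space scale
  for scale :: "'k::field \<Rightarrow> 'a::ab_group_add \<Rightarrow> 'a" (infixr \<open>*s\<close> 75) +
  fixes mult :: "'a \<Rightarrow> 'a \<Rightarrow> 'a"  (infixl \<open>\<cdot>\<close> 70)
  assumes linear_left: "Vector_Spaces.linear scale scale (\<lambda>x. x \<cdot> y)"
    and linear_right: "Vector_Spaces.linear scale scale (\<lambda>y. x \<cdot> y)"
    and left_leibniz: "x \<cdot> (y \<cdot> z) = (x \<cdot> y) \<cdot> z + y \<cdot> (x \<cdot> z)"

(* Right powers start at exponent 1; the value at exponent 0 is a placeholder. *)
fun right_power :: "('a::zero \<Rightarrow> 'a \<Rightarrow> 'a) \<Rightarrow> 'a \<Rightarrow> nat \<Rightarrow> 'a" where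
  "right_power mult x 0 = 0"
| "right_power mult x (Suc 0) = x"
| "right_power mult x (Suc (Suc n)) = mult (right_power mult x (Suc n)) x"

definition power_associative :: "('a::zero \<Rightarrow> 'a \<Rightarrow> 'a) \<Rightarrow> bool" where
  "power_associative mult \<longleftrightarrow>
    (\<forall>x. \<forall>n\<ge>2. \<forall>i\<in>{1..n - 1}.
      right_power mult x n = mult (right_power mult x (n - i)) (right_power mult x i))"

end

theory Submission
  imports Defs
begin

text \<open>The left Leibniz identity forces every square to act as zero by left multiplication
  (\<open>square_mult_eq_zero\<close>). Hence x^3 = x^2 x = 0, and all later right powers vanish
  with it. Among the products of powers compared in power-associativity, only x times x^2 is then
  neither x^n by definition nor automatically zero, so the property reduces to its
  vanishing.\<close>

context left_leibniz_algebra
begin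

lemma mult_zero_left [simp]: "0 \<cdot> y = 0"
  by (rule module_hom.zero[OF Vector_Spaces.linear.axioms(3)[OF linear_left[of y]]])

lemma mult_zero_right [simp]: "x \<cdot> 0 = 0"
  by (rule module_hom.zero[OF Vector_Spaces.linear.axioms(3)[OF linear_right[of x]]])

text \<open>Setting both first arguments of the Leibniz identity to \<open>x\<close> puts
  \<open>x \<cdot> (x \<cdot> y)\<close> on each side, where it cancels.\<close>

lemma square_mult_eq_zero: "(x \<cdot> x) \<cdot> y = 0"
  using left_leibniz[of x x y] by simp

lemma right_power_eq_zero:
  assumes "n \<ge> 3"
  shows "right_power (\<cdot>) x n = 0"
  using assms
proof (induction n rule: dec_induct)
  case base
  show ?case by (simp add: numeral_3_eq_3 square_mult_eq_zero)
next
  case (step n)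
  then obtain m where "n = Suc m" by (cases n) auto
  with step show ?case by simp
qed

lemma power_associative_iff:
  "power_associative (\<cdot>) \<longleftrightarrow> (\<forall>x. x \<cdot> right_power (\<cdot>) x 2 = 0)"
proof
  assume pa: "power_associative (\<cdot>)"
  show "\<forall>x. x \<cdot> right_power (\<cdot>) x 2 = 0"
  proof
    fix x
    \<comment> \<open>The instance n = 3, i = 2; its left side is already zero.\<close>
    have "right_power (\<cdot>) x 3 = right_power (\<cdot>) x (3 - 2) \<cdot> right_power (\<cdot>) x 2"
      using pa[unfolded power_associative_def, rule_format, of 3 2 x] by simp
    then show "x \<cdot> right_power (\<cdot>) x 2 = 0"
      by (simp add: right_power_eq_zero)
  qed
next
  assume zero: "\<forall>x. x \<cdot> right_power (\<cdot>) x 2 = 0"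
  show "power_associative (\<cdot>)"
    unfolding power_associative_def
  proof (intro allI impI ballI)
    fix x and n i :: nat
    assume n: "n \<ge> 2" and i: "i \<in> {1..n - 1}"
    \<comment> \<open>Respectively: the recursion for right powers, the hypothesis, a left factor
      that is a square or zero, and a right factor that is zero.\<close>
    then consider "i = 1" | "i = 2" "n = 3" | "i = 2" "n \<ge> 4" | "i \<ge> 3" "n \<ge> 4"
      by fastforce
    then show "right_power (\<cdot>) x n = right_power (\<cdot>) x (n - i) \<cdot> right_power (\<cdot>) x i"
    proof cases
      case 1
      \<comment> \<open>The recursion for \<open>right_power\<close> only unfolds at a double
        successor.\<close>
      obtain m where "n = Suc (Suc m)"
        using n by (metis add_2_eq_Suc le_Suc_ex)
      with 1 show ?thesis by simp
    next
      case 2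
      with zero show ?thesis by (simp add: right_power_eq_zero)
    next
      case 3
      then consider "n - i = 2" | "n - i \<ge> 3" by linarith
      then have "right_power (\<cdot>) x (n - i) \<cdot> y = 0" for y
        by cases (simp_all add: numeral_2_eq_2 square_mult_eq_zero right_power_eq_zero)
      with 3 show ?thesis by (simp add: right_power_eq_zero)
    next
      case 4
      then show ?thesis by (simp add: right_power_eq_zero)
    qed
  qed
qed

end

theorem corollary3p8:
  fixes scale :: "'k::field_char_0 \<Rightarrow> 'a::ab_group_add \<Rightarrow> 'a"
    and mult :: "'a \<Rightarrow> 'a \<Rightarrow> 'a"
  assumes "left_leibniz_algebra scale mult"
  shows "(\<forall>n\<ge>3. \<forall>x. right_power mult x n = 0) \<and>
    (power_associative mult \<longleftrightarrow> (\<forall>x. mult x (right_power mult x 2) = 0))"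
proof -
  interpret left_leibniz_algebra scale mult by fact
  show ?thesis using right_power_eq_zero power_associative_iff by blast
qed

end
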